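(* The Shannon capacity region (in packets per slot, in the limit of packet length $u\to\infty$) of the random access multicast system with two sources and two destinations, having reception probabilities $q_{n|n}^{(m)}$ and $q_{n|1,2}^{(m)}$ for $n,m\in\{1,2\}$, is the closure of the set of rate pairs $(R_1,R_2)$ for which $$R_1<\min_{m=1,2}\left[p_1(1-p_2)q_{1|1}^{(m)}+p_1p_2\,q_{1|1,2}^{(m)}\right],$$ $$R_2<\min_{m=1,2}\left[(1-p_1)p_2\,q_{2|2}^{(m)}+p_1p_2\,q_{2|1,2}^{(m)}\right]$$ for some $(p_1,p_2)\in[0,1]^2$.
   Context: System: time is slotted and two always-backlogged sources $n=1,2$ multicast to two destinations $m=1,2$. In each slot source $n$ transmits a packet with probability $p_n$, independently of the other source. $q_{n|n}^{(m)}$ is the probability that the packet from source $n$ is received at destination $m$ given that only source $n$ transmits. $q_{n|1,2}^{(m)}$ is the probability that the packet from source $n$ is received at destination $m$ given that both sources transmit. It is assumed that $q_{n|n}^{(m)}>q_{n|1,2}^{(m)}$ for all $n,m$, and that the channels of different source-destination pairs are independent. A packet that is not received is lost (erased). Channel for packet length $u$ bits: the input alphabet of each source is $\mathcal X=\{0,1,\dots,2^u\}$, where $0$ is the idle symbol and the other $2^u$ symbols are packets. The inputs $X_1,X_2$ are independent with $\Pr\{X_n=0\}=1-p_n$ and $\Pr\{X_n=x\}=p_n/2^u$ for $x=1,\dots,2^u$. The output at destination $m$ is $Y_m=(Y_{1m},Y_{2m})$ with values in $(\mathcal X\cup\{\Delta\})^2$, where $\Delta$ denotes a packet in error. If $X_n=0$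 then $Y_{nm}=0$. If $X_n\neq0$ then $Y_{nm}=X_n$ with probability $q_{n|n}^{(m)}$ (when the other source is idle) or $q_{n|1,2}^{(m)}$ (when the other source transmits), and $Y_{nm}=\Delta$ otherwise, independently across source-destination pairs given the inputs. Capacity region: for a general discrete memoryless channel with two sources and two destinations, codeword-asynchronous and symbol-synchronous transmission, no feedback, and every message to be decoded at both destinations, the capacity region is the closure of the set of $(R_1,R_2)$ (rates are nonnegative) such that, for some product input distribution, $R_1<I(X_1;Y_m|X_2)$, $R_2<I(X_2;Y_m|X_1)$ and $R_1+R_2<I(X_1,X_2;Y_m)$ hold for both $m=1,2$. The capacity region of the random access system is this region for the channel above, with input distributions ranging over the family just described, parametrized by $(p_1,p_2)\in[0,1]^2$. Rates are measured in packets per slot and timing information is excluded: for each $(p_1,p_2)$ the mutual informations (in bits) are divided by $u$ and replaced by their limits as $u\to\infty$. *)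

theory Defs
  imports "HOL-Probability.Probability"
begin

text \<open>
  Mutual information in bits. On a countable range the product of two discrete measurable spaces is
  again discrete, so these are the usual quantities of discrete random variables.
\<close>

definition mutual_info :: "'s pmf \<Rightarrow> ('s \<Rightarrow> 'a) \<Rightarrow> ('s \<Rightarrow> 'b) \<Rightarrow> real" where
  "mutual_info P X Y =
     prob_space.mutual_information (measure_pmf P) 2 (count_space UNIV) (count_space UNIV) X Y"

definition cond_mutual_info ::
    "'s pmf \<Rightarrow> ('s \<Rightarrow> 'a) \<Rightarrow> ('s \<Rightarrow> 'b) \<Rightarrow> ('s \<Rightarrow> 'c) \<Rightarrow> real" where
  "cond_mutual_info P X Y Z =
     prob_space.conditional_mutual_information (measure_pmf P) 2
       (count_space UNIV) (count_space UNIV) (count_space UNIV) X Y Z"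

text \<open>
  A two-source channel maps the pair of inputs to the joint law of the outputs at all destinations;
  a sample point is \<open>(x1, x2, y)\<close>, where \<open>y m\<close> is the output at destination \<open>m\<close>.
\<close>

definition joint_pmf ::
    "'x pmf \<Rightarrow> 'x pmf \<Rightarrow> ('x \<Rightarrow> 'x \<Rightarrow> (nat \<Rightarrow> 'y) pmf) \<Rightarrow> ('x \<times> 'x \<times> (nat \<Rightarrow> 'y)) pmf" where
  "joint_pmf P1 P2 W =
     bind_pmf P1 (\<lambda>x1. bind_pmf P2 (\<lambda>x2. map_pmf (\<lambda>y. (x1, x2, y)) (W x1 x2)))"

definition info_1 ::
    "'x pmf \<Rightarrow> 'x pmf \<Rightarrow> ('x \<Rightarrow> 'x \<Rightarrow> (nat \<Rightarrow> 'y) pmf) \<Rightarrow> nat \<Rightarrow> real" where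
  "info_1 P1 P2 W m =
     cond_mutual_info (joint_pmf P1 P2 W)
       (\<lambda>(x1, x2, y). x1) (\<lambda>(x1, x2, y). y m) (\<lambda>(x1, x2, y). x2)"

definition info_2 ::
    "'x pmf \<Rightarrow> 'x pmf \<Rightarrow> ('x \<Rightarrow> 'x \<Rightarrow> (nat \<Rightarrow> 'y) pmf) \<Rightarrow> nat \<Rightarrow> real" where
  "info_2 P1 P2 W m =
     cond_mutual_info (joint_pmf P1 P2 W)
       (\<lambda>(x1, x2, y). x2) (\<lambda>(x1, x2, y). y m) (\<lambda>(x1, x2, y). x1)"

definition info_12 ::
    "'x pmf \<Rightarrow> 'x pmf \<Rightarrow> ('x \<Rightarrow> 'x \<Rightarrow> (nat \<Rightarrow> 'y) pmf) \<Rightarrow> nat \<Rightarrow> real" where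
  "info_12 P1 P2 W m =
     mutual_info (joint_pmf P1 P2 W)
       (\<lambda>(x1, x2, y). (x1, x2)) (\<lambda>(x1, x2, y). y m)"

text \<open>The input symbol \<open>0\<close> is idle; the packets of \<open>u\<close> bits are \<open>1, \<dots>, 2 ^ u\<close>.\<close>

definition input_pmf :: "nat \<Rightarrow> real \<Rightarrow> nat pmf" where
  "input_pmf u p =
     bind_pmf (bernoulli_pmf p) (\<lambda>b. if b then pmf_of_set {1..2 ^ u} else return_pmf 0)"

text \<open>One source-destination link; the output \<open>None\<close> is a packet in error.\<close>

definition link_pmf :: "real \<Rightarrow> nat \<Rightarrow> nat option pmf" where
  "link_pmf q x =
     (if x = 0 then return_pmf (Some 0)
      else map_pmf (\<lambda>b. if b then Some x else None) (bernoulli_pmf q))"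

text \<open>
  \<open>q_alone n m\<close> and \<open>q_both n m\<close> are the probabilities that the packet of source \<open>n\<close> is received at
  destination \<open>m\<close> when only source \<open>n\<close>, respectively both sources, transmit. The default value
  \<open>(None, None)\<close> is the output at indices that are not destinations.
\<close>

definition random_access_channel ::
    "(nat \<Rightarrow> nat \<Rightarrow> real) \<Rightarrow> (nat \<Rightarrow> nat \<Rightarrow> real) \<Rightarrow> nat \<Rightarrow> nat \<Rightarrow>
     (nat \<Rightarrow> nat option \<times> nat option) pmf" where
  "random_access_channel q_alone q_both x1 x2 =
     (let q = (if x1 \<noteq> 0 \<and> x2 \<noteq> 0 then q_both else q_alone)
      in Pi_pmf {1, 2} (None, None) (\<lambda>m. pair_pmf (link_pmf (q 1 m) x1) (link_pmf (q 2 m) x2)))"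

text \<open>
  Rates are in packets per slot: \<open>I1\<close>, \<open>I2\<close> and \<open>I12\<close> are the limits, required to exist, of the
  mutual informations per packet bit.
\<close>

definition random_access_capacity_region ::
    "(nat \<Rightarrow> nat \<Rightarrow> real) \<Rightarrow> (nat \<Rightarrow> nat \<Rightarrow> real) \<Rightarrow> (real \<times> real) set" where
  "random_access_capacity_region q_alone q_both =
     (let W = random_access_channel q_alone q_both in
      closure {(R1, R2). 0 \<le> R1 \<and> 0 \<le> R2 \<and>
        (\<exists>p1\<in>{0..1}. \<exists>p2\<in>{0..1}. \<forall>m\<in>{1, 2}. \<exists>I1 I2 I12.
           (\<lambda>u. info_1 (input_pmf u p1) (input_pmf u p2) W m / real u) \<longlonglongrightarrow> I1 \<and>
           (\<lambda>u. info_2 (input_pmf u p1) (input_pmf u p2) W m / real u) \<longlonglongrightarrow> I2 \<and>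
           (\<lambda>u. info_12 (input_pmf u p1) (input_pmf u p2) W m / real u) \<longlonglongrightarrow> I12 \<and>
           R1 < I1 \<and> R2 < I2 \<and> R1 + R2 < I12)})"

end

theory Submission
  imports Defs
begin

text \<open>
  An output symbol of a link reveals the packet, the idle state, or only the fact that some packet
  was sent. Given the outputs, each input therefore follows its own law conditioned on the set of
  inputs consistent with its link, and the mutual informations are exact expectations of
  \<open>- log\<close> of the prior probability of that set. This probability is \<open>p / 2 ^ u\<close> if the packet is
  received and does not depend on \<open>u\<close> otherwise, so the information per packet bit tends to the
  probability of reception. For both sources jointly the informations add up, which makes the
  sum-rate constraint redundant.
\<close>

section \<open>Mutual information of discrete random variables\<close>

text \<open>Mutual information compares the joint law with the product of the marginals. With that
  product again a pmf, both laws have densities with respect to the same counting measure;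
  countability makes the product sigma-algebra discrete.\<close>

lemma pair_measure_pmf_eq:
  fixes A :: "'a::countable pmf" and B :: "'b::countable pmf"
  shows "measure_pmf A \<Otimes>\<^sub>M measure_pmf B = measure_pmf (pair_pmf A B)"
proof -
  have B: "measure_pmf B = density (count_space UNIV) (pmf B)"
    by (rule measure_pmf_eq_density)
  have "density (count_space UNIV) (pmf A) \<Otimes>\<^sub>M density (count_space UNIV) (pmf B) =
     density (count_space UNIV \<Otimes>\<^sub>M count_space UNIV) (\<lambda>(x, y). ennreal (pmf A x) * ennreal (pmf B y))"
    using sigma_finite_measure_count_space
    by (intro pair_measure_density) (auto simp: B[symmetric] measure_pmf.sigma_finite_measure_axioms)
  also have "\<dots> = density (count_space UNIV) (pmf (pair_pmf A B))"
    by (simp add: pair_measure_countable case_prod_beta' pmf_pair[symmetric] ennreal_mult'[symmetric])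
  finally show ?thesis by (simp add: measure_pmf_eq_density)
qed

text \<open>The divergence of two densities over counting measure is a sum of log ratios weighted by
  the joint law. Absolute continuity holds because a pair with positive joint mass has positive mass
  in both marginals.\<close>

lemma mutual_info_eq_expectation:
  fixes X :: "'s \<Rightarrow> 'a::countable" and Y :: "'s \<Rightarrow> 'b::countable"
  shows "mutual_info P X Y = measure_pmf.expectation P (\<lambda>s. log 2
    (pmf (map_pmf (\<lambda>s. (X s, Y s)) P) (X s, Y s) / (pmf (map_pmf X P) (X s) * pmf (map_pmf Y P) (Y s))))"
proof -
  let ?J = "map_pmf (\<lambda>s. (X s, Y s)) P" and ?Q = "pair_pmf (map_pmf X P) (map_pmf Y P)"
  interpret C: sigma_finite_measure "count_space UNIV :: ('a \<times> 'b) measure"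
    by (rule sigma_finite_measure_count_space)
  have ac: "pmf ?Q z = 0 \<longrightarrow> pmf ?J z = 0" for z
    by (cases z) (auto simp: pmf_eq_0_set_pmf)
  have "mutual_info P X Y = KL_divergence 2 (measure_pmf ?Q) (measure_pmf ?J)"
    by (simp add: mutual_info_def map_pmf_rep_eq[symmetric]
        prob_space.mutual_information_def[OF measure_pmf.prob_space_axioms]
        pair_measure_pmf_eq pair_measure_countable)
  also have "\<dots> = (\<integral>z. pmf ?J z * log 2 (pmf ?J z / pmf ?Q z) \<partial>count_space UNIV)"
    unfolding measure_pmf_eq_density using ac by (intro C.KL_density_density) auto
  also have "\<dots> = measure_pmf.expectation ?J (\<lambda>z. log 2 (pmf ?J z / pmf ?Q z))"
    unfolding measure_pmf_eq_density by (subst integral_real_density) auto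
  finally show ?thesis by (simp add: pmf_pair)
qed

text \<open>In the following two lemmas \<open>y\<close> reveals exactly that \<open>x\<close> lies in \<open>C y\<close>.\<close>

lemma pmf_map_snd_of_sections:
  assumes J: "\<And>x y. pmf J (x, y) = (if x \<in> C y then pmf Q x * g y else 0)" and g: "\<And>y. 0 \<le> g y"
  shows "pmf (map_pmf snd J) y = measure_pmf.prob Q (C y) * g y"
proof -
  \<comment> \<open>The fibre over \<open>y\<close> is parametrised by the first coordinate, which
    turns the mass of the fibre into a sum over \<open>x\<close>.\<close>
  have bij: "bij_betw (\<lambda>x. (x, y)) UNIV (snd -` {y})"
    by (rule bij_betwI[where g = fst]) auto
  have "ennreal (pmf (map_pmf snd J) y) = emeasure J (snd -` {y})"
    by (simp add: ennreal_pmf_map)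
  also have "\<dots> = (\<integral>\<^sup>+z. pmf J z \<partial>count_space (snd -` {y}))"
    by (simp add: nn_integral_pmf)
  also have "\<dots> = (\<integral>\<^sup>+x. pmf J (x, y) \<partial>count_space UNIV)"
    by (rule nn_integral_bij_count_space[OF bij, symmetric])
  also have "\<dots> = (\<integral>\<^sup>+x. (ennreal (pmf Q x) * indicator (C y) x) * g y \<partial>count_space UNIV)"
    by (intro nn_integral_cong) (auto simp: J ennreal_mult' g)
  also have "\<dots> = (\<integral>\<^sup>+x. ennreal (pmf Q x) * indicator (C y) x \<partial>count_space UNIV) * g y"
    by (rule nn_integral_multc) simp
  also have "\<dots> = emeasure Q (C y) * g y"
    by (simp add: nn_integral_pmf[symmetric] nn_integral_count_space_indicator)
  also have "\<dots> = ennreal (measure_pmf.prob Q (C y) * g y)"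
    by (simp add: measure_pmf.emeasure_eq_measure ennreal_mult' g)
  finally show ?thesis by (simp add: g)
qed

lemma mutual_info_of_sections:
  fixes X :: "'s \<Rightarrow> 'a::countable" and Y :: "'s \<Rightarrow> 'b::countable"
  assumes X: "map_pmf X P = Q"
    and J: "\<And>x y. pmf (map_pmf (\<lambda>s. (X s, Y s)) P) (x, y) = (if x \<in> C y then pmf Q x * g y else 0)"
    and g: "\<And>y. 0 \<le> g y"
  shows "mutual_info P X Y = - measure_pmf.expectation P (\<lambda>s. log 2 (measure_pmf.prob Q (C (Y s))))"
proof -
  let ?J = "map_pmf (\<lambda>s. (X s, Y s)) P"
  have Y: "pmf (map_pmf Y P) y = measure_pmf.prob Q (C y) * g y" for y
    using pmf_map_snd_of_sections[of ?J C Q g y, OF J g] by (simp add: pmf.map_comp o_def)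
  have "log 2 (pmf ?J (X s, Y s) / (pmf (map_pmf X P) (X s) * pmf (map_pmf Y P) (Y s))) =
      - log 2 (measure_pmf.prob Q (C (Y s)))" if "s \<in> set_pmf P" for s
  proof -
    have "(X s, Y s) \<in> set_pmf ?J" using that by auto
    then have "pmf ?J (X s, Y s) \<noteq> 0" by (simp only: set_pmf_iff not_False_eq_True)
    \<comment> \<open>On the support all factors of the joint mass are nonzero, so
      \<open>pmf Q x * g y\<close> cancels against the product of the marginals and leaves only the
      inverse of the probability of \<open>C y\<close>.\<close>
    then have nz: "X s \<in> C (Y s)" "pmf Q (X s) \<noteq> 0" "g (Y s) \<noteq> 0"
      by (auto simp: J split: if_splits)
    then have "pmf ?J (X s, Y s) / (pmf (map_pmf X P) (X s) * pmf (map_pmf Y P) (Y s)) =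
        inverse (measure_pmf.prob Q (C (Y s)))"
      unfolding X Y J by (simp add: field_simps)
    then show ?thesis by (simp only: log_inverse)
  qed
  then show ?thesis
    unfolding mutual_info_eq_expectation Bochner_Integration.integral_minus[symmetric]
    by (intro integral_cong_AE) (simp_all add: AE_measure_pmf_iff)
qed

section \<open>Joint law of the inputs and one output\<close>

text \<open>Chain rule: only the branch \<open>x = a\<close> of the mixture can produce a pair with
  first entry \<open>a\<close>.\<close>

lemma pmf_bind_map_Pair:
  "pmf (bind_pmf P (\<lambda>x. map_pmf (Pair x) (K x))) (a, b) = pmf P a * pmf (K a) b"
proof -
  have "pmf (map_pmf (Pair x) (K x)) (a, b) = indicator {a} x * pmf (K a) b" for x
  proof (cases "x = a")
    case True
    then show ?thesis using pmf_map_inj'[of "Pair a" "K a" b] by (auto simp: inj_on_def)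
  next
    case False
    then show ?thesis by (auto simp: pmf_eq_0_set_pmf)
  qed
  then show ?thesis by (simp add: pmf_bind measure_pmf_single)
qed

lemma pmf_joint_output:
  "pmf (map_pmf (\<lambda>(x1, x2, y). (x1, x2, y m)) (joint_pmf P1 P2 W)) (x1, x2, y) =
     pmf P1 x1 * pmf P2 x2 * pmf (map_pmf (\<lambda>y. y m) (W x1 x2)) y"
proof -
  have "map_pmf (\<lambda>(x1, x2, y). (x1, x2, y m)) (joint_pmf P1 P2 W) =
      bind_pmf P1 (\<lambda>x1. map_pmf (Pair x1) (bind_pmf P2 (\<lambda>x2.
        map_pmf (Pair x2) (map_pmf (\<lambda>y. y m) (W x1 x2)))))"
    by (simp add: joint_pmf_def map_bind_pmf pmf.map_comp o_def)
  then show ?thesis by (simp add: pmf_bind_map_Pair)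
qed

lemma map_joint_pmf_inputs:
  "map_pmf (\<lambda>(x1, x2, y). (x1, x2)) (joint_pmf P1 P2 W) = pair_pmf P1 P2"
  by (simp add: joint_pmf_def map_bind_pmf pmf.map_comp o_def map_pmf_const pair_pmf_def)

lemma map_joint_pmf_input_1: "map_pmf (\<lambda>(x1, x2, y). x1) (joint_pmf P1 P2 W) = P1"
  by (simp add: joint_pmf_def map_bind_pmf pmf.map_comp o_def map_pmf_const bind_return_pmf')

lemma map_joint_pmf_input_2: "map_pmf (\<lambda>(x1, x2, y). x2) (joint_pmf P1 P2 W) = P2"
  by (simp add: joint_pmf_def map_bind_pmf pmf.map_comp o_def map_pmf_const bind_return_pmf')

section \<open>Likelihoods of a single link\<close>

text \<open>An erasure tells only that some packet was sent. Its set is left unbounded, so that one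
  definition serves all packet lengths; the prior cuts it down to the actual alphabet.\<close>

definition consistent_inputs :: "nat option \<Rightarrow> nat set" where
  "consistent_inputs y = (case y of None \<Rightarrow> {0<..} | Some x \<Rightarrow> {x})"

text \<open>The likelihood of the output \<open>y\<close> under any input consistent with it. That
  it is the same for all these inputs makes the posterior a conditioned prior.\<close>

definition link_weight :: "real \<Rightarrow> nat option \<Rightarrow> real" where
  "link_weight q y = (if y = None then 1 - q else if y = Some 0 then 1 else q)"

lemma pmf_link_pmf:
  assumes "0 \<le> q" "q \<le> 1"
  shows "pmf (link_pmf q x) y = (if x \<in> consistent_inputs y then link_weight q y else 0)"
proof -
  have inj: "inj (\<lambda>b. if b then Some x else None)" by (auto simp: inj_def)
  consider "y = Some x" | "y = None" | "y \<notin> {Some x, None}" by auto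
  then show ?thesis
  proof cases
    case 1
    then show ?thesis using pmf_map_inj'[OF inj, of "bernoulli_pmf q" True] assms
      by (auto simp: link_pmf_def consistent_inputs_def link_weight_def)
  next
    case 2
    then show ?thesis using pmf_map_inj'[OF inj, of "bernoulli_pmf q" False] assms
      by (auto simp: link_pmf_def consistent_inputs_def link_weight_def)
  next
    case 3
    then have "y \<notin> set_pmf (link_pmf q x)" by (auto simp: link_pmf_def)
    then have "pmf (link_pmf q x) y = 0" by (simp add: set_pmf_iff)
    with 3 show ?thesis by (cases y) (auto simp: consistent_inputs_def)
  qed
qed

lemma map_random_access_channel:
  assumes "m \<in> {1, 2}"
  shows "map_pmf (\<lambda>y. y m) (random_access_channel a b x1 x2) =
    (let q = (if x1 \<noteq> 0 \<and> x2 \<noteq> 0 then b else a)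
     in pair_pmf (link_pmf (q 1 m) x1) (link_pmf (q 2 m) x2))"
  using assms by (auto simp: random_access_channel_def Let_def Pi_pmf_component)

lemma finite_set_random_access_channel: "finite (set_pmf (random_access_channel a b x1 x2))"
  unfolding random_access_channel_def Let_def
  by (subst set_Pi_pmf) (auto intro!: finite_PiE_dflt simp: link_pmf_def)

lemma finite_set_input_pmf: "finite (set_pmf (input_pmf u p))"
  by (auto simp: input_pmf_def)

lemma finite_set_joint_pmf:
  assumes "finite (set_pmf P1)" "finite (set_pmf P2)" "\<And>x1 x2. finite (set_pmf (W x1 x2))"
  shows "finite (set_pmf (joint_pmf P1 P2 W))"
  using assms by (auto simp: joint_pmf_def)

section \<open>Exact mutual informations at one destination\<close>

text \<open>The exact formulas hold for any finitely supported input laws; the packet law enters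
  only with the limit in \<open>u\<close>. Finite support supplies the integrability for splitting
  an expectation of a sum.\<close>

locale random_access_link =
  fixes a b :: "nat \<Rightarrow> nat \<Rightarrow> real" and P1 P2 :: "nat pmf" and m :: nat
  assumes a: "\<And>n. n \<in> {1, 2} \<Longrightarrow> 0 \<le> a n m \<and> a n m \<le> 1"
    and b: "\<And>n. n \<in> {1, 2} \<Longrightarrow> 0 \<le> b n m \<and> b n m \<le> 1"
    and m: "m \<in> {1, 2}"
    and finite_inputs: "finite (set_pmf P1)" "finite (set_pmf P2)"
begin

abbreviation joint where
  "joint \<equiv> joint_pmf P1 P2 (random_access_channel a b)"

definition output_weight :: "nat option \<times> nat option \<Rightarrow> real" where
  "output_weight y =
     (let q = (if fst y \<noteq> Some 0 \<and> snd y \<noteq> Some 0 then b else a)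
      in link_weight (q 1 m) (fst y) * link_weight (q 2 m) (snd y))"

lemma output_weight_nonneg: "0 \<le> output_weight y"
  using a b by (auto simp: output_weight_def link_weight_def Let_def)

text \<open>The choice between \<open>a\<close> and \<open>b\<close> depends on both inputs and
  couples the two links. A source is idle exactly if its output is \<open>Some 0\<close>, so the
  choice can be read off from \<open>y\<close> and the likelihood is a weight of \<open>y\<close>
  alone on a rectangle of inputs.\<close>

lemma pmf_output:
  "pmf (map_pmf (\<lambda>y. y m) (random_access_channel a b x1 x2)) y =
    (if x1 \<in> consistent_inputs (fst y) \<and> x2 \<in> consistent_inputs (snd y) then output_weight y else 0)"
proof -
  have idle: "x = 0 \<longleftrightarrow> z = Some 0" if "x \<in> consistent_inputs z" for x z
    using that by (auto simp: consistent_inputs_def split: option.splits)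
  show ?thesis using a b
    by (cases y) (auto simp: map_random_access_channel[OF m] Let_def pmf_pair pmf_link_pmf
        output_weight_def dest: idle)
qed

lemma pmf_joint:
  "pmf (map_pmf (\<lambda>(x1, x2, y). (x1, x2, y m)) joint) (x1, x2, y) =
    (if x1 \<in> consistent_inputs (fst y) \<and> x2 \<in> consistent_inputs (snd y)
     then pmf P1 x1 * pmf P2 x2 * output_weight y else 0)"
  unfolding pmf_joint_output pmf_output by simp

text \<open>Independent inputs reveal nothing about each other: every section is
  \<open>UNIV\<close>, of probability 1. This removes the subtracted term in the definition of
  conditional mutual information.\<close>

lemma mutual_info_inputs:
  "mutual_info joint (\<lambda>(x1, x2, y). x1) (\<lambda>(x1, x2, y). x2) = 0"
  "mutual_info joint (\<lambda>(x1, x2, y). x2) (\<lambda>(x1, x2, y). x1) = 0"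
proof -
  have "map_pmf (\<lambda>s. (case s of (x1, x2, y) \<Rightarrow> x1, case s of (x1, x2, y) \<Rightarrow> x2)) joint = pair_pmf P1 P2"
    by (subst map_joint_pmf_inputs[symmetric]) (auto intro!: map_pmf_cong)
  then show "mutual_info joint (\<lambda>(x1, x2, y). x1) (\<lambda>(x1, x2, y). x2) = 0"
    by (subst mutual_info_of_sections[where Q = P1 and C = "\<lambda>_. UNIV" and g = "pmf P2"])
       (auto simp: map_joint_pmf_input_1[unfolded case_prod_unfold] pmf_pair case_prod_unfold)
  have "map_pmf (\<lambda>s. (case s of (x1, x2, y) \<Rightarrow> x2, case s of (x1, x2, y) \<Rightarrow> x1)) joint = pair_pmf P2 P1"
    by (subst pair_commute_pmf, subst map_joint_pmf_inputs[symmetric])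
       (auto simp: pmf.map_comp intro!: map_pmf_cong)
  then show "mutual_info joint (\<lambda>(x1, x2, y). x2) (\<lambda>(x1, x2, y). x1) = 0"
    by (subst mutual_info_of_sections[where Q = P2 and C = "\<lambda>_. UNIV" and g = "pmf P1"])
       (auto simp: map_joint_pmf_input_2[unfolded case_prod_unfold] pmf_pair case_prod_unfold)
qed

text \<open>The map \<open>f\<close> reorders and regroups the triple so that the variable to be
  inferred comes first and the observation second; injectivity preserves the masses.\<close>

lemma pmf_map_joint:
  assumes "inj f"
  shows "pmf (map_pmf (\<lambda>(x1, x2, y). f (x1, x2, y m)) joint) (f (x1, x2, y)) =
    (if x1 \<in> consistent_inputs (fst y) \<and> x2 \<in> consistent_inputs (snd y)
     then pmf P1 x1 * pmf P2 x2 * output_weight y else 0)"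
proof -
  have "map_pmf (\<lambda>(x1, x2, y). f (x1, x2, y m)) joint =
      map_pmf f (map_pmf (\<lambda>(x1, x2, y). (x1, x2, y m)) joint)"
    by (auto simp: pmf.map_comp intro!: map_pmf_cong)
  then show ?thesis by (simp only: pmf_map_inj'[OF assms] pmf_joint)
qed

text \<open>I(X1; Y | X2) is I(X1; (Y, X2)) - I(X1; X2), and the second term vanishes. Given
  \<open>y\<close>, the other input \<open>x2\<close> says nothing more about \<open>x1\<close>, so
  the section depends on the first link's output only.\<close>

lemma info_1_eq:
  "info_1 P1 P2 (random_access_channel a b) m = - measure_pmf.expectation joint
     (\<lambda>(x1, x2, y). log 2 (measure_pmf.prob P1 (consistent_inputs (fst (y m)))))"
proof -
  define f :: "nat \<times> nat \<times> nat option \<times> nat option \<Rightarrow> _" where "f = (\<lambda>(x1, x2, y). (x1, y, x2))"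
  have "inj f" by (auto simp: f_def inj_def)
  note J = pmf_map_joint[OF this, unfolded f_def split]
  \<comment> \<open>All factors free of \<open>x1\<close>: the consistency of \<open>x2\<close> with
    its own output, its prior and the output weight.\<close>
  let ?g = "\<lambda>(y, x2). if x2 \<in> consistent_inputs (snd y) then pmf P2 x2 * output_weight y else 0"
  have "mutual_info joint (\<lambda>(x1, x2, y). x1) (\<lambda>s. (case s of (x1, x2, y) \<Rightarrow> y m, case s of (x1, x2, y) \<Rightarrow> x2)) =
    - measure_pmf.expectation joint (\<lambda>s. log 2 (measure_pmf.prob P1
        (consistent_inputs (fst (fst (case s of (x1, x2, y) \<Rightarrow> y m, case s of (x1, x2, y) \<Rightarrow> x2))))))"
    using J
    by (intro mutual_info_of_sections[where g = ?g])
       (auto simp: map_joint_pmf_input_1[unfolded case_prod_unfold] output_weight_nonneg case_prod_unfold)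
  then show ?thesis
    using mutual_info_inputs(1)
    by (simp add: info_1_def cond_mutual_info_def mutual_info_def pair_measure_countable
        prob_space.conditional_mutual_information_def[OF measure_pmf.prob_space_axioms] case_prod_unfold)
qed

lemma info_2_eq:
  "info_2 P1 P2 (random_access_channel a b) m = - measure_pmf.expectation joint
     (\<lambda>(x1, x2, y). log 2 (measure_pmf.prob P2 (consistent_inputs (snd (y m)))))"
proof -
  define f :: "nat \<times> nat \<times> nat option \<times> nat option \<Rightarrow> _" where "f = (\<lambda>(x1, x2, y). (x2, y, x1))"
  have "inj f" by (auto simp: f_def inj_def)
  note J = pmf_map_joint[OF this, unfolded f_def split]
  let ?g = "\<lambda>(y, x1). if x1 \<in> consistent_inputs (fst y) then pmf P1 x1 * output_weight y else 0"
  have "mutual_info joint (\<lambda>(x1, x2, y). x2) (\<lambda>s. (case s of (x1, x2, y) \<Rightarrow> y m, case s of (x1, x2, y) \<Rightarrow> x1)) =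
    - measure_pmf.expectation joint (\<lambda>s. log 2 (measure_pmf.prob P2
        (consistent_inputs (snd (fst (case s of (x1, x2, y) \<Rightarrow> y m, case s of (x1, x2, y) \<Rightarrow> x1))))))"
    using J
    by (intro mutual_info_of_sections[where g = ?g])
       (auto simp: map_joint_pmf_input_2[unfolded case_prod_unfold] output_weight_nonneg case_prod_unfold)
  then show ?thesis
    using mutual_info_inputs(2)
    by (simp add: info_2_def cond_mutual_info_def mutual_info_def pair_measure_countable
        prob_space.conditional_mutual_information_def[OF measure_pmf.prob_space_axioms] case_prod_unfold)
qed

text \<open>The actual input is consistent with its output and has positive prior mass. Positivity
  is what allows the logarithm of a product to be split.\<close>

lemma prob_consistent_inputs_pos:
  assumes "(x1, x2, y) \<in> set_pmf joint"
  shows "0 < measure_pmf.prob P1 (consistent_inputs (fst (y m)))"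
    and "0 < measure_pmf.prob P2 (consistent_inputs (snd (y m)))"
proof -
  have "(x1, x2, y m) \<in> set_pmf (map_pmf (\<lambda>(x1, x2, y). (x1, x2, y m)) joint)"
    using assms by force
  then have "pmf (map_pmf (\<lambda>(x1, x2, y). (x1, x2, y m)) joint) (x1, x2, y m) \<noteq> 0"
    by (simp only: set_pmf_iff not_False_eq_True)
  then have "x1 \<in> consistent_inputs (fst (y m))" "pmf P1 x1 \<noteq> 0"
      "x2 \<in> consistent_inputs (snd (y m))" "pmf P2 x2 \<noteq> 0"
    unfolding pmf_joint by (auto split: if_splits)
  then show "0 < measure_pmf.prob P1 (consistent_inputs (fst (y m)))"
    and "0 < measure_pmf.prob P2 (consistent_inputs (snd (y m)))"
    by (auto intro!: measure_pmf_posI simp: set_pmf_iff)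
qed

text \<open>The input pairs consistent with an output form a rectangle, whose probability under the
  product prior is a product; its logarithm is the sum of the two integrands of the conditional
  informations.\<close>

lemma info_12_eq:
  "info_12 P1 P2 (random_access_channel a b) m =
     info_1 P1 P2 (random_access_channel a b) m + info_2 P1 P2 (random_access_channel a b) m"
proof -
  let ?c1 = "\<lambda>(x1, x2, y). measure_pmf.prob P1 (consistent_inputs (fst (y m)))"
  let ?c2 = "\<lambda>(x1, x2, y). measure_pmf.prob P2 (consistent_inputs (snd (y m)))"
  define f :: "nat \<times> nat \<times> nat option \<times> nat option \<Rightarrow> _" where "f = (\<lambda>(x1, x2, y). ((x1, x2), y))"
  have "inj f" by (auto simp: f_def inj_def)
  note J = pmf_map_joint[OF this, unfolded f_def split]
  have "info_12 P1 P2 (random_access_channel a b) m =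
    - measure_pmf.expectation joint (\<lambda>s. log 2 (measure_pmf.prob (pair_pmf P1 P2)
        (consistent_inputs (fst (case s of (x1, x2, y) \<Rightarrow> y m)) \<times>
         consistent_inputs (snd (case s of (x1, x2, y) \<Rightarrow> y m)))))"
    unfolding info_12_def using J
    by (intro mutual_info_of_sections[where g = output_weight
          and C = "\<lambda>y. consistent_inputs (fst y) \<times> consistent_inputs (snd y)"])
       (auto simp: map_joint_pmf_inputs[unfolded case_prod_unfold] output_weight_nonneg case_prod_unfold pmf_pair
          split: if_splits)
  also have "\<dots> = - measure_pmf.expectation joint (\<lambda>s. log 2 (?c1 s) + log 2 (?c2 s))"
  proof -
    have "log 2 (measure_pmf.prob (pair_pmf P1 P2)
        (consistent_inputs (fst (y m)) \<times> consistent_inputs (snd (y m)))) =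
        log 2 (measure_pmf.prob P1 (consistent_inputs (fst (y m)))) +
        log 2 (measure_pmf.prob P2 (consistent_inputs (snd (y m))))"
      if "(x1, x2, y) \<in> set_pmf joint" for x1 x2 y
      using prob_consistent_inputs_pos[OF that] by (simp add: measure_pmf_prob_product log_mult)
    then show ?thesis
      by (intro arg_cong[where f = uminus] integral_cong_AE) (auto simp: AE_measure_pmf_iff)
  qed
  also have "\<dots> = - measure_pmf.expectation joint (\<lambda>s. log 2 (?c1 s)) -
      measure_pmf.expectation joint (\<lambda>s. log 2 (?c2 s))"
    using finite_inputs
    by (simp add: integrable_measure_pmf_finite finite_set_joint_pmf finite_set_random_access_channel)
  finally show ?thesis by (simp add: info_1_eq info_2_eq case_prod_unfold)
qed

lemma map_joint_pmf_output_1: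
  "map_pmf (\<lambda>(x1, x2, y). fst (y m)) joint =
     bind_pmf P1 (\<lambda>x1. bind_pmf P2 (\<lambda>x2.
       link_pmf (if x1 \<noteq> 0 \<and> x2 \<noteq> 0 then b 1 m else a 1 m) x1))"
proof -
  have "map_pmf (\<lambda>y. fst (y m)) (random_access_channel a b x1 x2) =
      link_pmf (if x1 \<noteq> 0 \<and> x2 \<noteq> 0 then b 1 m else a 1 m) x1" for x1 x2
    using map_random_access_channel[OF m, of a b x1 x2, THEN arg_cong[where f = "map_pmf fst"]]
    by (simp add: pmf.map_comp o_def Let_def map_fst_pair_pmf split: if_splits)
  then show ?thesis by (simp add: joint_pmf_def map_bind_pmf pmf.map_comp o_def)
qed

text \<open>The two inputs are drawn in exchanged order, own source first, so that both sources get
  a law of the same shape and one limit computation serves both.\<close>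

lemma map_joint_pmf_output_2:
  "map_pmf (\<lambda>(x1, x2, y). snd (y m)) joint =
     bind_pmf P2 (\<lambda>x2. bind_pmf P1 (\<lambda>x1.
       link_pmf (if x2 \<noteq> 0 \<and> x1 \<noteq> 0 then b 2 m else a 2 m) x2))"
proof -
  have "map_pmf (\<lambda>y. snd (y m)) (random_access_channel a b x1 x2) =
      link_pmf (if x2 \<noteq> 0 \<and> x1 \<noteq> 0 then b 2 m else a 2 m) x2" for x1 x2
    using map_random_access_channel[OF m, of a b x1 x2, THEN arg_cong[where f = "map_pmf snd"]]
    by (simp add: pmf.map_comp o_def Let_def map_snd_pair_pmf conj_commute split: if_splits)
  then show ?thesis
    by (simp add: joint_pmf_def map_bind_pmf pmf.map_comp o_def) (rule bind_commute_pmf)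
qed

end

section \<open>Packet inputs and the limit of long packets\<close>

lemma map_input_pmf_active: "map_pmf (\<lambda>x. x \<noteq> 0) (input_pmf u p) = bernoulli_pmf p"
proof -
  have "map_pmf (\<lambda>x. x \<noteq> 0) (pmf_of_set {1..2 ^ u :: nat}) = map_pmf (\<lambda>_. True) (pmf_of_set {1..2 ^ u :: nat})"
    by (intro map_pmf_cong) auto
  then have "map_pmf (\<lambda>x. x \<noteq> 0) (input_pmf u p) = bind_pmf (bernoulli_pmf p) return_pmf"
    unfolding input_pmf_def map_bind_pmf by (intro bind_pmf_cong) (auto simp: map_pmf_const)
  then show ?thesis by (simp add: bind_return_pmf')
qed

text \<open>Here the packet length enters: only a received packet has a prior depending on
  \<open>u\<close>, and its factor \<open>1 / 2 ^ u\<close> is worth \<open>u\<close> bits.\<close>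

lemma prob_input_consistent:
  assumes p: "p \<in> {0..1}"
  shows "measure_pmf.prob (input_pmf u p) (consistent_inputs y) =
    (case y of None \<Rightarrow> p | Some x \<Rightarrow> if x = 0 then 1 - p else if x \<le> 2 ^ u then p / 2 ^ u else 0)"
proof (cases y)
  case None
  have "measure_pmf.prob (input_pmf u p) {0<..} = pmf (bernoulli_pmf p) True"
    unfolding map_input_pmf_active[of u, symmetric]
    by (auto simp: pmf_map intro!: arg_cong[where f = "measure_pmf.prob _"])
  with None p show ?thesis by (simp add: consistent_inputs_def)
next
  case (Some x)
  have "pmf (input_pmf u p) x = (if x = 0 then 1 - p else if x \<le> 2 ^ u then p / 2 ^ u else 0)"
    using p by (auto simp: input_pmf_def pmf_bind pmf_of_set indicator_def)
  with Some show ?thesis by (simp add: consistent_inputs_def measure_pmf_single)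
qed

text \<open>\<open>P\<close> is the input law of the link's source, \<open>Q\<close> that of the interfering source.\<close>

definition link_law :: "nat pmf \<Rightarrow> nat pmf \<Rightarrow> real \<Rightarrow> real \<Rightarrow> nat option pmf" where
  "link_law P Q qa qb =
     bind_pmf P (\<lambda>x. bind_pmf Q (\<lambda>z. link_pmf (if x \<noteq> 0 \<and> z \<noteq> 0 then qb else qa) x))"

text \<open>The complement of \<open>{None, Some 0}\<close> is the event that a packet is received.
  It depends on the inputs only through which sources are active, so the computation reduces to
  Bernoulli variables.\<close>

lemma prob_link_law_received:
  assumes "p \<in> {0..1}" "p' \<in> {0..1}" "0 \<le> qa" "qa \<le> 1" "0 \<le> qb" "qb \<le> 1"
  shows "measure_pmf.prob (link_law (input_pmf u p) (input_pmf u p') qa qb) (- {None, Some 0}) =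
    p * (1 - p') * qa + p * p' * qb"
proof -
  have link: "map_pmf (\<lambda>y. y \<notin> {None, Some 0}) (link_pmf q x) =
      (if x \<noteq> 0 then bernoulli_pmf q else return_pmf False)" for q x
  proof (cases "x = 0")
    case False
    have "map_pmf (\<lambda>y. y \<notin> {None, Some 0}) (link_pmf q x) = map_pmf (\<lambda>b. b) (bernoulli_pmf q)"
      using False by (auto simp: link_pmf_def map_pmf_comp intro!: map_pmf_cong)
    with False show ?thesis by (simp add: map_pmf_ident)
  qed (simp add: link_pmf_def)
  have "map_pmf (\<lambda>y. y \<notin> {None, Some 0}) (link_law (input_pmf u p) (input_pmf u p') qa qb) =
      bind_pmf (map_pmf (\<lambda>x. x \<noteq> 0) (input_pmf u p)) (\<lambda>s.
      bind_pmf (map_pmf (\<lambda>x. x \<noteq> 0) (input_pmf u p')) (\<lambda>t.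
        if s then bernoulli_pmf (if s \<and> t then qb else qa) else return_pmf False))"
    unfolding link_law_def map_bind_pmf bind_map_pmf link by simp
  also have "pmf \<dots> True = p * (1 - p') * qa + p * p' * qb"
    unfolding map_input_pmf_active using assms by (simp add: pmf_bind algebra_simps)
  finally show ?thesis by (simp add: pmf_map vimage_def Compl_eq)
qed

text \<open>The information is exactly \<open>u\<close> times the reception probability, up to an
  error bounded uniformly in \<open>u\<close>, which vanishes after division by
  \<open>u\<close>.\<close>

lemma expectation_link_law_asymptotics:
  assumes p: "p \<in> {0..1}" and "p' \<in> {0..1}" "0 \<le> qa" "qa \<le> 1" "0 \<le> qb" "qb \<le> 1"
  defines "L \<equiv> \<lambda>u. link_law (input_pmf u p) (input_pmf u p') qa qb"
  shows "(\<lambda>u. - measure_pmf.expectation (L u)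
      (\<lambda>y. log 2 (measure_pmf.prob (input_pmf u p) (consistent_inputs y))) / real u)
    \<longlonglongrightarrow> p * (1 - p') * qa + p * p' * qb"
proof -
  define A where "A = p * (1 - p') * qa + p * p' * qb"
  \<comment> \<open>The part of the log prior that is free of \<open>u\<close>. As
    \<open>log\<close> is total, the bound \<open>c\<close> is a real number also for
    \<open>p = 0\<close> and \<open>p = 1\<close>.\<close>
  define h where "h y = (if y = Some 0 then log 2 (1 - p) else log 2 p)" for y :: "nat option"
  define c where "c = \<bar>log 2 (1 - p)\<bar> + \<bar>log 2 p\<bar>"
  define e where "e u = measure_pmf.expectation (L u) h" for u
  have fin: "finite (set_pmf (L u))" for u
    by (auto simp: L_def link_law_def link_pmf_def finite_set_input_pmf)
  have e: "\<bar>e u\<bar> \<le> c" for u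
  proof -
    have "\<bar>e u\<bar> \<le> measure_pmf.expectation (L u) (\<lambda>y. \<bar>h y\<bar>)"
      unfolding e_def by (rule integral_abs_bound)
    also have "\<dots> \<le> measure_pmf.expectation (L u) (\<lambda>y. c)"
      by (intro integral_mono integrable_measure_pmf_finite fin) (auto simp: h_def c_def)
    finally show ?thesis by simp
  qed
  have eq: "- measure_pmf.expectation (L u)
      (\<lambda>y. log 2 (measure_pmf.prob (input_pmf u p) (consistent_inputs y))) = real u * A - e u" for u
  proof -
    have "log 2 (measure_pmf.prob (input_pmf u p) (consistent_inputs y)) =
        h y - real u * indicator (- {None, Some 0}) y" if y: "y \<in> set_pmf (L u)" for y
    proof -
      obtain x where x: "x \<in> set_pmf (input_pmf u p)" "y = Some x \<or> y = None"
        using y by (auto simp: L_def link_law_def link_pmf_def split: if_splits)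
      show ?thesis
      proof (cases "y = None \<or> y = Some 0")
        case True
        then show ?thesis by (auto simp: prob_input_consistent[OF p] h_def)
      next
        case False
        with x have "y = Some x" "x \<noteq> 0" by auto
        \<comment> \<open>A packet that was actually received has positive prior, which excludes
          \<open>p = 0\<close> and symbols outside the alphabet; hence the logarithm of
          \<open>p / 2 ^ u\<close> splits.\<close>
        moreover have "pmf (input_pmf u p) x \<noteq> 0" using x by (simp add: set_pmf_iff)
        then have "measure_pmf.prob (input_pmf u p) (consistent_inputs (Some x)) \<noteq> 0"
          by (simp add: consistent_inputs_def measure_pmf_single)
        then have "p \<noteq> 0" "x \<le> 2 ^ u"
          using \<open>x \<noteq> 0\<close> by (auto simp: prob_input_consistent[OF p] split: if_splits)
        ultimately show ?thesis using p
          by (simp add: prob_input_consistent[OF p] h_def log_divide log_nat_power)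
      qed
    qed
    then have "measure_pmf.expectation (L u)
        (\<lambda>y. log 2 (measure_pmf.prob (input_pmf u p) (consistent_inputs y))) =
        measure_pmf.expectation (L u) (\<lambda>y. h y - real u * indicator (- {None, Some 0}) y)"
      by (intro integral_cong_AE) (auto simp: AE_measure_pmf_iff)
    also have "\<dots> = e u - real u * measure_pmf.prob (L u) (- {None, Some 0})"
      by (subst Bochner_Integration.integral_diff)
         (auto simp: e_def intro!: integrable_measure_pmf_finite fin)
    also have "measure_pmf.prob (L u) (- {None, Some 0}) = A"
      unfolding L_def A_def using assms by (intro prob_link_law_received)
    finally show ?thesis by simp
  qed
  have "(\<lambda>u. e u / real u) \<longlonglongrightarrow> 0"
  proof (rule Lim_null_comparison)
    show "(\<lambda>u. c / real u) \<longlonglongrightarrow> 0" by (rule lim_const_over_n)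
  qed (auto intro!: always_eventually divide_right_mono e)
  then have "(\<lambda>u. A - e u / real u) \<longlonglongrightarrow> A - 0"
    by (intro tendsto_diff tendsto_const)
  \<comment> \<open>The two sides may differ at \<open>u = 0\<close>, where division by zero yields
    0.\<close>
  moreover have "\<forall>\<^sub>F u in sequentially. A - e u / real u = (real u * A - e u) / real u"
    using eventually_gt_at_top[of 0] by eventually_elim (simp add: field_simps)
  ultimately show ?thesis
    unfolding eq A_def[symmetric] by (simp add: Lim_transform_eventually)
qed

lemma random_access_info_tendsto:
  assumes a: "\<And>n. n \<in> {1, 2} \<Longrightarrow> 0 \<le> a n m \<and> a n m \<le> 1"
    and b: "\<And>n. n \<in> {1, 2} \<Longrightarrow> 0 \<le> b n m \<and> b n m \<le> 1"
    and m: "m \<in> {1, 2}" and p: "p1 \<in> {0..1}" "p2 \<in> {0..1}"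
  defines "W \<equiv> random_access_channel a b"
    and "A1 \<equiv> p1 * (1 - p2) * a 1 m + p1 * p2 * b 1 m"
    and "A2 \<equiv> (1 - p1) * p2 * a 2 m + p1 * p2 * b 2 m"
  shows "(\<lambda>u. info_1 (input_pmf u p1) (input_pmf u p2) W m / real u) \<longlonglongrightarrow> A1"
    and "(\<lambda>u. info_2 (input_pmf u p1) (input_pmf u p2) W m / real u) \<longlonglongrightarrow> A2"
    and "(\<lambda>u. info_12 (input_pmf u p1) (input_pmf u p2) W m / real u) \<longlonglongrightarrow> A1 + A2"
proof -
  have L: "random_access_link a b (input_pmf u p1) (input_pmf u p2) m" for u
    using a b m by unfold_locales (auto simp: finite_set_input_pmf)
  have i1: "info_1 (input_pmf u p1) (input_pmf u p2) W m =
     - measure_pmf.expectation (link_law (input_pmf u p1) (input_pmf u p2) (a 1 m) (b 1 m))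
      (\<lambda>y. log 2 (measure_pmf.prob (input_pmf u p1) (consistent_inputs y)))" for u
    unfolding W_def random_access_link.info_1_eq[OF L] link_law_def
      random_access_link.map_joint_pmf_output_1[OF L, symmetric]
    by (simp add: case_prod_unfold)
  have i2: "info_2 (input_pmf u p1) (input_pmf u p2) W m =
     - measure_pmf.expectation (link_law (input_pmf u p2) (input_pmf u p1) (a 2 m) (b 2 m))
      (\<lambda>y. log 2 (measure_pmf.prob (input_pmf u p2) (consistent_inputs y)))" for u
    unfolding W_def random_access_link.info_2_eq[OF L] link_law_def
      random_access_link.map_joint_pmf_output_2[OF L, symmetric]
    by (simp add: case_prod_unfold)
  show 1: "(\<lambda>u. info_1 (input_pmf u p1) (input_pmf u p2) W m / real u) \<longlonglongrightarrow> A1"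
    unfolding i1 A1_def using a[of 1] b[of 1] p by (intro expectation_link_law_asymptotics) auto
  \<comment> \<open>Rearranged with the own transmission probability first, as in the limit lemma
    applied to source 2.\<close>
  have "A2 = p2 * (1 - p1) * a 2 m + p2 * p1 * b 2 m"
    by (simp add: A2_def mult.commute)
  then show 2: "(\<lambda>u. info_2 (input_pmf u p1) (input_pmf u p2) W m / real u) \<longlonglongrightarrow> A2"
    unfolding i2 using a[of 2] b[of 2] p by (simp only:) (intro expectation_link_law_asymptotics; auto)
  show "(\<lambda>u. info_12 (input_pmf u p1) (input_pmf u p2) W m / real u) \<longlonglongrightarrow> A1 + A2"
    using tendsto_add[OF 1 2] unfolding W_def random_access_link.info_12_eq[OF L]
    by (simp add: add_divide_distrib)
qed

section \<open>Equality of the two rate regions\<close>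

theorem corollary2:
  fixes q_alone q_both :: "nat \<Rightarrow> nat \<Rightarrow> real"
  assumes "\<And>n m. n \<in> {1, 2} \<Longrightarrow> m \<in> {1, 2} \<Longrightarrow> 0 \<le> q_alone n m \<and> q_alone n m \<le> 1"
    and "\<And>n m. n \<in> {1, 2} \<Longrightarrow> m \<in> {1, 2} \<Longrightarrow> 0 \<le> q_both n m \<and> q_both n m \<le> 1"
    and "\<And>n m. n \<in> {1, 2} \<Longrightarrow> m \<in> {1, 2} \<Longrightarrow> q_alone n m > q_both n m"
  shows "random_access_capacity_region q_alone q_both =
    closure {(R1, R2). 0 \<le> R1 \<and> 0 \<le> R2 \<and>
      (\<exists>p1\<in>{0..1}. \<exists>p2\<in>{0..1}.
         R1 < (MIN m\<in>{1, 2}. p1 * (1 - p2) * q_alone 1 m + p1 * p2 * q_both 1 m) \<and>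
         R2 < (MIN m\<in>{1, 2}. (1 - p1) * p2 * q_alone 2 m + p1 * p2 * q_both 2 m))}"
proof -
  let ?W = "random_access_channel q_alone q_both"
  let ?A1 = "\<lambda>p1 p2 m. p1 * (1 - p2) * q_alone 1 m + p1 * p2 * q_both 1 m"
  let ?A2 = "\<lambda>p1 p2 m. (1 - p1) * p2 * q_alone 2 m + p1 * p2 * q_both 2 m"
  \<comment> \<open>Uniqueness of limits identifies \<open>I1\<close> and \<open>I2\<close> in one
    direction. In the other, the sum bound follows by adding the two single bounds, since the limit
    of the joint information is the sum of the two limits.\<close>
  have limits: "(\<exists>I1 I2 I12.
        (\<lambda>u. info_1 (input_pmf u p1) (input_pmf u p2) ?W m / real u) \<longlonglongrightarrow> I1 \<and>
        (\<lambda>u. info_2 (input_pmf u p1) (input_pmf u p2) ?W m / real u) \<longlonglongrightarrow> I2 \<and>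
        (\<lambda>u. info_12 (input_pmf u p1) (input_pmf u p2) ?W m / real u) \<longlonglongrightarrow> I12 \<and>
        R1 < I1 \<and> R2 < I2 \<and> R1 + R2 < I12) \<longleftrightarrow> R1 < ?A1 p1 p2 m \<and> R2 < ?A2 p1 p2 m"
    if "p1 \<in> {0..1}" "p2 \<in> {0..1}" "m \<in> {1, 2}" for p1 p2 m R1 R2
  proof -
    note T = random_access_info_tendsto[where a = q_alone and b = q_both and m = m,
        OF assms(1)[OF _ that(3)] assms(2)[OF _ that(3)] that(3,1,2)]
    show ?thesis
    proof
      assume "R1 < ?A1 p1 p2 m \<and> R2 < ?A2 p1 p2 m"
      then show "\<exists>I1 I2 I12.
        (\<lambda>u. info_1 (input_pmf u p1) (input_pmf u p2) ?W m / real u) \<longlonglongrightarrow> I1 \<and>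
        (\<lambda>u. info_2 (input_pmf u p1) (input_pmf u p2) ?W m / real u) \<longlonglongrightarrow> I2 \<and>
        (\<lambda>u. info_12 (input_pmf u p1) (input_pmf u p2) ?W m / real u) \<longlonglongrightarrow> I12 \<and>
        R1 < I1 \<and> R2 < I2 \<and> R1 + R2 < I12"
        using T by (intro exI conjI) (assumption | simp)+
    qed (use LIMSEQ_unique T(1,2) in blast)
  qed
  have "(\<forall>m\<in>{1, 2}. \<exists>I1 I2 I12.
        (\<lambda>u. info_1 (input_pmf u p1) (input_pmf u p2) ?W m / real u) \<longlonglongrightarrow> I1 \<and>
        (\<lambda>u. info_2 (input_pmf u p1) (input_pmf u p2) ?W m / real u) \<longlonglongrightarrow> I2 \<and>
        (\<lambda>u. info_12 (input_pmf u p1) (input_pmf u p2) ?W m / real u) \<longlonglongrightarrow> I12 \<and>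
        R1 < I1 \<and> R2 < I2 \<and> R1 + R2 < I12) \<longleftrightarrow>
      R1 < (MIN m\<in>{1, 2}. ?A1 p1 p2 m) \<and> R2 < (MIN m\<in>{1, 2}. ?A2 p1 p2 m)"
    if "p1 \<in> {0..1}" "p2 \<in> {0..1}" for p1 p2 R1 R2
    using limits[OF that] by auto
  then show ?thesis
    unfolding random_access_capacity_region_def Let_def
    by (intro arg_cong[where f = closure] Collect_cong prod.case_cong conj_cong bex_cong refl)
qed

end
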